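(* Let every point of the Euclidean space $\mathbb{E}^3$ be coloured either red or blue so that there are no two red points at distance $1$ apart. Then there exist six blue points that form an $\ell_6$.
   Context: $\mathbb{E}^3$ is three-dimensional Euclidean space with the usual distance. For a positive integer $i$, $\ell_i$ denotes a configuration of $i$ collinear points with distance $1$ between any two consecutive points, i.e. a set of points $p, p+v, p+2v, \dots, p+(i-1)v$ with $v$ a unit vector. Points "form an $\ell_i$" if they are such a configuration (a congruent copy of $\ell_i$). *)

theory Defs
  imports "HOL-Analysis.Analysis"
begin

datatype colour = Red | Blue

text \<open>
  \<open>forms_ell i S\<close>: the points of \<open>S\<close> are \<open>i\<close> collinear points with distance 1
  between consecutive ones, i.e. \<open>S = {p, p + v, ..., p + (i - 1) v}\<close> for a unit
  vector \<open>v\<close>.  Meant for \<open>i > 0\<close>.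
\<close>

definition forms_ell :: "nat \<Rightarrow> 'a::euclidean_space set \<Rightarrow> bool" where
  "forms_ell i S \<longleftrightarrow> (\<exists>p v. norm v = 1 \<and> S = (\<lambda>k. p + real k *\<^sub>R v) ` {..<i})"

end

theory Submission
  imports Defs
begin

text \<open>
  Suppose that red points are never at distance 1 and that every \<open>\<ell>\<^sub>6\<close> contains a red
  point. The core of the argument is that a red point \<open>x\<close> then forces every point at
  distance 5 from \<open>x\<close> to be red as well. The sphere of radius 5 contains two points at
  distance 1, a contradiction.

  To reach the distance 5, place a face-centred cubic lattice with minimal distance 1 through a
  pair of red points. In this lattice every point has twelve neighbours, and the lines through
  neighbours contain many \<open>\<ell>\<^sub>6\<close>: whenever five points of one of these are at an excluded distance
  from red points already found, the sixth is red. Chains of such deductions show that certain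
  distances do not occur between red points. Since all placements of the lattice are
  available, an exclusion obtained for one lattice vector holds for all pairs of points in
  space with that distance, and it strengthens all later deductions. In this way the
  distances \<open>2, \<surd>6, 3, 4, \<surd>19, 6\<close> are excluded one after the other, each with the help of
  the previous ones. Among the six points \<open>x + v, \<dots>, x + 6v\<close> on a line through a red point
  \<open>x\<close>, only \<open>x + 5v\<close> can then be red, and one of the six must be.

  The lattice alone cannot give a contradiction: with the lattice identified with the integer
  vectors \<open>(n\<^sub>0, n\<^sub>1, n\<^sub>2, n\<^sub>3)\<close> of sum 0, the points with \<open>n\<^sub>1 + 2n\<^sub>2 + 3n\<^sub>3\<close> divisible by 5
  form a red set on it that satisfies both conditions. This is the pattern of period 5 that the
  proof detects, and only the freedom to rotate the line refutes it.
\<close>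

section \<open>Red points on the face-centred cubic lattice\<close>

text \<open>
  Integer triples serve as coordinates, scaled such that squared length 2 is the unit distance;
  the twelve triples of squared length 2 are the directions of the lattice lines. A squared
  length \<open>n\<close> corresponds to the distance \<open>\<surd>(n / 2)\<close>. The set \<open>N\<close> collects the
  squared lengths known not to occur between red points. The triples with even sum
  form the lattice; those with odd sum form a translate of it, which obeys the same conditions.
\<close>

locale lattice_pattern =
  fixes N :: "int set" and F :: "int \<Rightarrow> int \<Rightarrow> int \<Rightarrow> bool"
  assumes apart: "F x y z \<Longrightarrow> F x' y' z' \<Longrightarrow>
      (x' - x)\<^sup>2 + (y' - y)\<^sup>2 + (z' - z)\<^sup>2 \<notin> N"
    and row: "a\<^sup>2 + b\<^sup>2 + c\<^sup>2 = 2 \<Longrightarrow>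
      F x y z \<or> F (x + a) (y + b) (z + c) \<or> F (x + 2 * a) (y + 2 * b) (z + 2 * c) \<or>
      F (x + 3 * a) (y + 3 * b) (z + 3 * c) \<or> F (x + 4 * a) (y + 4 * b) (z + 4 * c) \<or>
      F (x + 5 * a) (y + 5 * b) (z + 5 * c)"
begin

text \<open>
  The form in which the first condition is used: \<open>near[OF r]\<close>, for a red point \<open>r\<close>,
  is a conditional rewrite rule that decides by arithmetic which points \<open>r\<close> makes blue.
  Every deduction below names a row (by direction and first point) and the red points that
  make five of its points blue.
\<close>

lemma near:
  "F x y z \<Longrightarrow> (x' - x)\<^sup>2 + (y' - y)\<^sup>2 + (z' - z)\<^sup>2 \<in> N \<Longrightarrow> \<not> F x' y' z'"
  using apart by blast

end

section \<open>Excluding distance 2\<close>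

text \<open>
  On each lattice line parallel to that of the pair and at distance \<open>\<surd>3 / 2\<close> from it, four
  consecutive points are at distance 1 from one of the two red points. So the two points before
  these four contain a red one, and so do the two points after them; and only three of the four
  combinations meet all rows of six. For a given height \<open>z\<close> there are two such lines, at distance 1 from each
  other, and this leaves two possibilities, called types below, which the
  reflection exchanging the first two coordinates maps to each other.
\<close>

lemma row_types:
  assumes "lattice_pattern {2} F" and o1: "F (-1) (-1) 0" and o2: "F 1 1 0"
    and z: "z = 1 \<or> z = -1"
  shows "F (-4) (-3) z \<and> F (-2) (-3) z \<and> F 2 3 z \<and> F 4 3 z \<or>
    F (-3) (-4) z \<and> F (-3) (-2) z \<and> F 3 2 z \<and> F 3 4 z"
proof -
  interpret lattice_pattern "{2}" F by fact
  have z2: "z\<^sup>2 = 1" "(- z)\<^sup>2 = 1"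
    using z by auto
  note near_o = near[OF o1] near[OF o2]
  show ?thesis
  proof (cases "F (-2) (-3) z")
    case True
    have r1: "F (-4) (-3) z"
      using row[of 1 1 0 "-4" "-3" z] by (simp add: near_o near[OF True] z2)
    have r2: "F 2 3 z"
      using row[of 1 1 0 "-3" "-2" z] by (simp add: near_o near[OF True] z2)
    have "F 4 3 z"
      using row[of 1 1 0 "-1" "-2" z] by (simp add: near_o near[OF r2] z2)
    with True r1 r2 show ?thesis by blast
  next
    case False
    have r1: "F (-3) (-4) z"
      using row[of 1 1 0 "-3" "-4" z] False by (simp add: near_o z2)
    have r2: "F 3 2 z"
      using row[of 1 1 0 "-2" "-3" z] False by (simp add: near_o z2)
    have r3: "F (-3) (-2) z"
      using row[of 1 1 0 "-4" "-3" z] by (simp add: near_o near[OF r1] z2)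
    have "F 3 4 z"
      using row[of 1 1 0 "-2" "-1" z] by (simp add: near_o near[OF r2] z2)
    with r1 r2 r3 show ?thesis by blast
  qed
qed

text \<open>
  If the rows at height 1 and the rows at height -1 carry different types, the whole
  configuration is invariant under the half turn \<open>(x, y, z) \<mapsto> (y, x, - z)\<close> about the
  line of the pair. The two red points forced in addition in the two cases below,
  \<open>(1, -1, 0)\<close> and \<open>(-1, 1, 0)\<close>, are exchanged by that half turn.
\<close>

lemma opposite_types_impossible:
  assumes "lattice_pattern {2} F"
    and o1: "F (-1) (-1) 0"
    and o2: "F 1 1 0"
    and a2: "F (-2) (-3) 1"
    and a3: "F 2 3 1"
    and b2: "F (-3) (-2) (-1)"
    and b3: "F 3 2 (-1)"
  shows False
proof -
  interpret lattice_pattern "{2}" F by fact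
  \<comment> \<open>The point \<open>(-1, 1, 0)\<close> is red in either case, and then a line through \<open>(-2, 2, -2)\<close>
      has no other undecided point than \<open>(-3, 2, -3)\<close>.\<close>
  show False
  proof (cases "F (-2) 2 (-2)")
    case True
    have r1: "F 1 (-1) 0"
      using row[of 1 1 0 "-1" "-3" 0]
      by (simp add: near[OF o1] near[OF o2] near[OF a2] near[OF b3])
    have r2: "F (-3) 4 (-1)"
      using row[of 1 "-1" 0 "-3" 4 "-1"]
      by (simp add: near[OF o2] near[OF True] near[OF r1])
    show False
      using row[of 1 "-1" 0 "-4" 3 "-1"]
      by (simp add: near[OF o1] near[OF True] near[OF r1] near[OF r2])
  next
    case False
    have r1: "F (-1) 1 0"
      using row[of 1 1 0 "-4" "-2" 0]
      by (simp add: near[OF o1] near[OF o2] near[OF a3] near[OF b2])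
    have r2: "F (-3) 2 (-3)"
      using row[of 1 0 1 "-3" 2 "-3"] False
      by (simp add: near[OF a3] near[OF r1])
    show False
      using row[of 0 1 "-1" "-2" "-2" 2] False
      by (simp add: near[OF o1] near[OF a2] near[OF r1] near[OF r2])
  qed
qed

text \<open>
  If both heights carry the same type, the configuration is symmetric in the plane
  \<open>z = 0\<close>. The six points starting at \<open>(-6, -6, -2)\<close> on a line parallel to the pair
  then include only three undecided ones, and each of these leads to a contradiction when it
  is red.
\<close>

lemma equal_types_impossible:
  assumes "lattice_pattern {2} F"
    and o1: "F (-1) (-1) 0"
    and a1: "F (-4) (-3) 1"
    and a2: "F (-2) (-3) 1"
    and b1: "F (-4) (-3) (-1)"
    and b2: "F (-2) (-3) (-1)"
  shows False
proof -
  interpret lattice_pattern "{2}" F by fact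
  have n1: "\<not> F (-6) (-6) (-2)"
  proof
    assume h: "F (-6) (-6) (-2)"
    have r1: "F (-5) (-1) 2"
      using row[of 0 1 1 "-5" "-6" "-3"]
      by (simp add: near[OF a1] near[OF b1] near[OF h])
    have r2: "F (-6) (-2) 4"
      using row[of 1 0 "-1" "-6" "-2" 4]
      by (simp add: near[OF o1] near[OF a1] near[OF r1])
    show False
      using row[of 1 0 "-1" "-7" "-2" 3]
      by (simp add: near[OF a1] near[OF b2] near[OF r1] near[OF r2])
  qed
  have n2: "\<not> F (-5) (-5) (-2)"
  proof
    assume h: "F (-5) (-5) (-2)"
    have r1: "F 0 (-4) 2"
      using row[of 1 0 1 "-5" "-4" "-3"]
      by (simp add: near[OF a2] near[OF b1] near[OF h])
    show False
      using row[of 1 0 1 "-6" "-4" "-2"]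
      by (simp add: near[OF a1] near[OF a2] near[OF h] near[OF r1])
  qed
  have n3: "\<not> F (-1) (-1) (-2)"
  proof
    assume h: "F (-1) (-1) (-2)"
    have r1: "F (-5) (-2) 3"
      using row[of 1 0 "-1" "-5" "-2" 3]
      by (simp add: near[OF o1] near[OF a1] near[OF h])
    show False
      using row[of 1 0 "-1" "-6" "-2" 2]
      by (simp add: near[OF a1] near[OF b1] near[OF h] near[OF r1])
  qed
  show False
    using row[of 1 1 0 "-6" "-6" "-2"] n1 n2 n3
    by (simp add: near[OF b1] near[OF b2])
qed

lemma lattice_pattern_swap:
  assumes "lattice_pattern N F"
  shows "lattice_pattern N (\<lambda>x y z. F y x z)"
proof -
  interpret lattice_pattern N F by fact
  show ?thesis
  proof
    fix x y z x' y' z'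
    assume "F y x z" "F y' x' z'"
    then show "(x' - x)\<^sup>2 + (y' - y)\<^sup>2 + (z' - z)\<^sup>2 \<notin> N"
      using apart[of y x z y' x' z'] by (simp add: add.commute)
  next
    fix a b c x y z :: int
    assume "a\<^sup>2 + b\<^sup>2 + c\<^sup>2 = 2"
    then show "F y x z \<or> F (y + b) (x + a) (z + c) \<or> F (y + 2 * b) (x + 2 * a) (z + 2 * c) \<or>
      F (y + 3 * b) (x + 3 * a) (z + 3 * c) \<or> F (y + 4 * b) (x + 4 * a) (z + 4 * c) \<or>
      F (y + 5 * b) (x + 5 * a) (z + 5 * c)"
      using row[of b a c y x z] by (simp add: add.commute)
  qed
qed

text \<open>
  Of the four combinations of types at the heights 1 and -1, the reflection exchanging the first
  two coordinates leaves two to refute.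
\<close>

lemma no_red_pair_at_distance_2:
  assumes F: "lattice_pattern {2} F" and o1: "F (-1) (-1) 0" and o2: "F 1 1 0"
  shows False
proof -
  note F' = lattice_pattern_swap[OF F]
  note opp = opposite_types_impossible[OF F] opposite_types_impossible[OF F']
  note same = equal_types_impossible[OF F] equal_types_impossible[OF F']
  show False
    using row_types[OF F o1 o2, of 1] row_types[OF F o1 o2, of "-1"] opp same o1 o2 by blast
qed

section \<open>Excluding the distances \<open>\<surd>6\<close>, 3, 4, \<open>\<surd>19\<close> and 6\<close>

text \<open>
  With distance 2 excluded, a red point makes 24 lattice points blue instead of 12, and
  from here on one case distinction is enough to exclude a further distance.
\<close>

lemma no_red_pair_at_distance_sqrt6:
  assumes "lattice_pattern {2, 8} F"
    and o1: "F 0 0 0"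
    and o2: "F 2 2 2"
  shows False
proof -
  interpret lattice_pattern "{2, 8}" F by fact
  \<comment> \<open>The other points of a line through \<open>(-3, -2, 1)\<close> and \<open>(-2, -1, 1)\<close> are already blue.\<close>
  show False
  proof (cases "F (-3) (-2) 1")
    case True
    have r1: "F (-1) (-2) 1"
      using row[of 1 1 0 "-2" "-3" 1]
      by (simp add: near[OF o1] near[OF o2] near[OF True])
    have r2: "F (-1) 1 2"
      using row[of 1 1 0 "-4" "-2" 2]
      by (simp add: near[OF o1] near[OF o2] near[OF True])
    have r3: "F 0 (-3) (-1)"
      using row[of 0 1 1 0 "-3" "-1"]
      by (simp add: near[OF o2] near[OF r1] near[OF r2])
    show False
      using row[of 0 1 1 1 "-3" "-2"]
      by (simp add: near[OF o1] near[OF o2] near[OF r3])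
  next
    case False
    have r1: "F (-2) (-1) 1"
      using row[of 1 1 0 "-3" "-2" 1] False
      by (simp add: near[OF o1] near[OF o2])
    have r2: "F (-3) 1 (-2)"
      using row[of 1 0 1 "-3" 1 "-2"]
      by (simp add: near[OF o1] near[OF o2] near[OF r1])
    have r3: "F (-2) (-3) 1"
      using row[of 1 1 0 "-2" "-3" 1]
      by (simp add: near[OF o1] near[OF o2] near[OF r1])
    have r4: "F 1 (-1) 2"
      using row[of 1 1 0 "-2" "-4" 2]
      by (simp add: near[OF o1] near[OF o2] near[OF r3])
    show False
      using row[of 1 0 1 "-3" 0 "-1"]
      by (simp add: near[OF o2] near[OF r1] near[OF r2] near[OF r4])
  qed
qed

text \<open>
  Although \<open>\<surd>6\<close> is not a distance between points of one line, its exclusion is a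
  step towards that of 3: it makes enough points off the line of the pair blue for one
  case distinction to suffice.
\<close>

lemma no_red_pair_at_distance_3:
  assumes "lattice_pattern {2, 8, 12} F"
    and o1: "F 0 0 0"
    and o2: "F 3 3 0"
  shows False
proof -
  interpret lattice_pattern "{2, 8, 12}" F by fact
  \<comment> \<open>On a line in direction \<open>(1, 1, 0)\<close> only \<open>(-1, 1, -2)\<close> and \<open>(2, 4, -2)\<close> are undecided.\<close>
  show False
  proof (cases "F (-1) 1 (-2)")
    case True
    have r1: "F 4 2 (-2)"
      using row[of 1 1 0 0 "-2" "-2"]
      by (simp add: near[OF o1] near[OF o2] near[OF True])
    have r2: "F (-1) (-1) (-2)"
      using row[of 1 1 0 "-2" "-2" "-2"]
      by (simp add: near[OF o1] near[OF o2] near[OF True] near[OF r1])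
    have r3: "F 1 2 (-1)"
      using row[of 1 1 0 "-2" "-1" "-1"]
      by (simp add: near[OF o1] near[OF o2] near[OF r2])
    show False
      using row[of 1 1 0 "-1" "-2" "-1"]
      by (simp add: near[OF o1] near[OF o2] near[OF r2] near[OF r3])
  next
    case False
    have r1: "F 2 4 (-2)"
      using row[of 1 1 0 "-2" 0 "-2"] False
      by (simp add: near[OF o1] near[OF o2])
    have r2: "F 1 (-1) (-2)"
      using row[of 1 1 0 0 "-2" "-2"]
      by (simp add: near[OF o1] near[OF o2] near[OF r1])
    have r3: "F (-1) (-1) (-2)"
      using row[of 1 1 0 "-2" "-2" "-2"]
      by (simp add: near[OF o1] near[OF o2] near[OF r1] near[OF r2])
    have r4: "F 2 1 (-1)"
      using row[of 1 1 0 "-1" "-2" "-1"]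
      by (simp add: near[OF o1] near[OF o2] near[OF r3])
    show False
      using row[of 1 1 0 "-2" "-1" "-1"]
      by (simp add: near[OF o1] near[OF o2] near[OF r3] near[OF r4])
  qed
qed

text \<open>
  The reflection exchanging the first two coordinates fixes both points of the pair, and
  it maps the two cases of the proof to each other.
\<close>

lemma no_red_pair_at_distance_4:
  assumes "lattice_pattern {2, 8, 12, 18} F"
    and o1: "F 0 0 0"
    and o2: "F 4 4 0"
  shows False
proof -
  interpret lattice_pattern "{2, 8, 12, 18}" F by fact
  \<comment> \<open>On a line in direction \<open>(1, -1, 0)\<close> only \<open>(1, 2, 1)\<close> and its mirror image \<open>(2, 1, 1)\<close>
      are undecided.\<close>
  show False
  proof (cases "F 1 2 1")
    case True
    have r1: "F (-1) 3 4"
      using row[of 1 0 "-1" "-1" 3 4]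
      by (simp add: near[OF o1] near[OF o2] near[OF True])
    show False
      using row[of 0 1 1 0 1 "-3"]
      by (simp add: near[OF o1] near[OF o2] near[OF True] near[OF r1])
  next
    case False
    have r1: "F 2 1 1"
      using row[of 1 "-1" 0 "-1" 4 1] False
      by (simp add: near[OF o1] near[OF o2])
    have r2: "F 3 (-1) 4"
      using row[of 0 1 "-1" 3 "-1" 4]
      by (simp add: near[OF o1] near[OF o2] near[OF r1])
    show False
      using row[of 1 0 1 1 0 "-3"]
      by (simp add: near[OF o1] near[OF o2] near[OF r1] near[OF r2])
  qed
qed

text \<open>
  Like \<open>\<surd>6\<close>, this distance does not occur on a line; its exclusion prepares that of
  distance 6.
\<close>

lemma no_red_pair_at_distance_sqrt19:
  assumes "lattice_pattern {2, 8, 12, 18, 32} F"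
    and o1: "F 0 0 0"
    and o2: "F 5 3 2"
  shows False
proof -
  interpret lattice_pattern "{2, 8, 12, 18, 32}" F by fact
  \<comment> \<open>On a line in direction \<open>(0, 1, 1)\<close> only \<open>(1, 3, 2)\<close> and \<open>(1, 5, 4)\<close> are undecided.\<close>
  show False
  proof (cases "F 1 3 2")
    case True
    have r1: "F 3 (-1) 0"
      using row[of 1 0 "-1" "-1" "-1" 4]
      by (simp add: near[OF o1] near[OF o2] near[OF True])
    show False
      using row[of 1 1 0 1 "-1" "-2"]
      by (simp add: near[OF o1] near[OF o2] near[OF True] near[OF r1])
  next
    case False
    have r1: "F 1 5 4"
      using row[of 0 1 1 1 0 "-1"] False
      by (simp add: near[OF o1] near[OF o2])
    show False
      using row[of 1 0 "-1" 0 1 5]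
      by (simp add: near[OF o1] near[OF o2] near[OF r1])
  qed
qed

text \<open>
  Red points with five blue points between them are compatible with the condition on
  every single line, so the contradiction has to come from lines transversal to the pair.
  The excluded distance \<open>\<surd>19\<close> makes it short.
\<close>

lemma no_red_pair_at_distance_6:
  assumes "lattice_pattern {2, 8, 12, 18, 32, 38} F"
    and o1: "F 0 0 0"
    and o2: "F 6 6 0"
  shows False
proof -
  interpret lattice_pattern "{2, 8, 12, 18, 32, 38}" F by fact
  \<comment> \<open>On a line in direction \<open>(1, 1, 0)\<close> only \<open>(-2, 1, -3)\<close> and \<open>(-1, 2, -3)\<close> are undecided.\<close>
  show False
  proof (cases "F (-2) 1 (-3)")
    case True
    show False
      using row[of 1 0 1 "-1" 1 "-2"]
      by (simp add: near[OF o2] near[OF True])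
  next
    case False
    have r1: "F (-1) 2 (-3)"
      using row[of 1 1 0 "-2" 1 "-3"] False
      by (simp add: near[OF o1] near[OF o2])
    show False
      using row[of 0 1 "-1" 1 "-1" 2]
      by (simp add: near[OF o1] near[OF o2] near[OF r1])
  qed
qed

section \<open>From the lattice to space\<close>

definition meets_all_ell6 :: "(real^3) set \<Rightarrow> bool" where
  "meets_all_ell6 R \<longleftrightarrow> (\<forall>p v. norm v = 1 \<longrightarrow> (\<exists>k<6. p + real k *\<^sub>R v \<in> R))"

text \<open>
  The argument \<open>n\<close> is a squared length in lattice coordinates, hence twice the squared
  distance: this makes the excluded distances, some of which are irrational, integers.
\<close>

definition omits :: "(real^3) set \<Rightarrow> int \<Rightarrow> bool" where
  "omits R n \<longleftrightarrow> (\<forall>x\<in>R. \<forall>y\<in>R. 2 * (dist x y)\<^sup>2 \<noteq> of_int n)"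

definition lattice_point :: "int \<Rightarrow> int \<Rightarrow> int \<Rightarrow> real^3" where
  "lattice_point i j k = (1 / sqrt 2) *\<^sub>R vector [of_int i, of_int j, of_int k]"

lemma norm_lattice_point: "2 * (norm (lattice_point i j k))\<^sup>2 = of_int (i\<^sup>2 + j\<^sup>2 + k\<^sup>2)"
  unfolding lattice_point_def norm_scaleR power_mult_distrib power2_norm_eq_inner
  by (simp add: inner_vec_def sum_3 power_divide power2_eq_square)

lemma lattice_point_add:
  "lattice_point (i + i') (j + j') (k + k') = lattice_point i j k + lattice_point i' j' k'"
  unfolding lattice_point_def by (simp add: vec_eq_iff forall_3 algebra_simps add_divide_distrib)

lemma lattice_point_diff:
  "lattice_point (i - i') (j - j') (k - k') = lattice_point i j k - lattice_point i' j' k'"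
  unfolding lattice_point_def by (simp add: vec_eq_iff forall_3 algebra_simps diff_divide_distrib)

lemma lattice_point_mult:
  "lattice_point (m * i) (m * j) (m * k) = of_int m *\<^sub>R lattice_point i j k"
  unfolding lattice_point_def by (simp add: vec_eq_iff forall_3)

text \<open>
  The group of isometries acts transitively on pairs of points with a given distance. So the
  lattice can be placed with two prescribed points of it on any red pair of matching distance,
  and the traces of the red set on all these copies of the lattice obey the same rules.
\<close>

lemma lattice_through_pair:
  assumes R: "meets_all_ell6 R" and N: "\<forall>n\<in>N. omits R n"
    and xy: "x \<in> R" "y \<in> R"
    and d: "2 * (dist x y)\<^sup>2 = of_int ((i' - i)\<^sup>2 + (j' - j)\<^sup>2 + (k' - k)\<^sup>2)"
  obtains F where "lattice_pattern N F" "F i j k" "F i' j' k'"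
proof -
  let ?w = "lattice_point (i' - i) (j' - j) (k' - k)"
  have "2 * (norm ?w)\<^sup>2 = 2 * (norm (y - x))\<^sup>2"
    unfolding norm_lattice_point using d by (simp add: dist_norm norm_minus_commute)
  then have "norm ?w = norm (y - x)"
    by simp
  then obtain f where f: "orthogonal_transformation f" and fw: "f ?w = y - x"
    by (rule orthogonal_transformation_exists)
  have lin: "linear f"
    using f by (simp add: orthogonal_transformation_def)
  define g where "g a b c = x + f (lattice_point (a - i) (b - j) (c - k))" for a b c
  have gdist: "2 * (dist (g a b c) (g a' b' c'))\<^sup>2 = of_int ((a' - a)\<^sup>2 + (b' - b)\<^sup>2 + (c' - c)\<^sup>2)"
    for a b c a' b' c'
  proof -
    have "dist (g a b c) (g a' b' c') = norm (lattice_point (a' - a) (b' - b) (c' - c))"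
      unfolding g_def dist_norm
      by (simp add: lattice_point_diff linear_diff[OF lin, symmetric]
          orthogonal_transformation_norm[OF f] norm_minus_commute)
    then show ?thesis
      by (simp only: norm_lattice_point)
  qed
  have grow: "g (a + m * a') (b + m * b') (c + m * c') = g a b c + of_int m *\<^sub>R f (lattice_point a' b' c')"
    for a b c a' b' c' m
    unfolding g_def
    by (simp add: lattice_point_diff lattice_point_add lattice_point_mult
        linear_diff[OF lin] linear_add[OF lin] linear_scale[OF lin])
  have "lattice_pattern N (\<lambda>a b c. g a b c \<in> R)"
  proof
    fix a b c a' b' c'
    assume "g a b c \<in> R" "g a' b' c' \<in> R"
    then show "(a' - a)\<^sup>2 + (b' - b)\<^sup>2 + (c' - c)\<^sup>2 \<notin> N"
      using N gdist unfolding omits_def by blast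
  next
    fix a b c a' b' c' :: int
    assume "a'\<^sup>2 + b'\<^sup>2 + c'\<^sup>2 = 2"
    then have "(norm (f (lattice_point a' b' c')))\<^sup>2 = 1"
      using norm_lattice_point[of a' b' c'] by (simp add: orthogonal_transformation_norm[OF f])
    then have "norm (f (lattice_point a' b' c')) = 1"
      using power2_eq_iff_nonneg[of "norm (f (lattice_point a' b' c'))" 1] by simp
    then obtain m where "m < 6" "g a b c + real m *\<^sub>R f (lattice_point a' b' c') \<in> R"
      using R unfolding meets_all_ell6_def by blast
    then have "m < 6" and in_R: "g (a + int m * a') (b + int m * b') (c + int m * c') \<in> R"
      by (simp_all add: grow)
    then consider "m = 0" | "m = 1" | "m = 2" | "m = 3" | "m = 4" | "m = 5"
      by linarith
    then show "g a b c \<in> R \<or> g (a + a') (b + b') (c + c') \<in> R \<or>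
      g (a + 2 * a') (b + 2 * b') (c + 2 * c') \<in> R \<or>
      g (a + 3 * a') (b + 3 * b') (c + 3 * c') \<in> R \<or>
      g (a + 4 * a') (b + 4 * b') (c + 4 * c') \<in> R \<or>
      g (a + 5 * a') (b + 5 * b') (c + 5 * c') \<in> R"
      by cases (use in_R in simp_all)
  qed
  moreover have "g i j k = x"
    using lattice_point_diff[of 0 0 0 0 0 0] linear_0[OF lin] by (simp add: g_def)
  moreover have "g i' j' k' = y"
    by (simp add: g_def fw)
  ultimately show thesis
    using that xy by simp
qed

text \<open>
  This turns a refutation on the lattice, for a single difference vector, into an exclusion of the
  corresponding distance in the whole space. The exclusion covers all difference
  vectors of the same length, also those not equivalent under the symmetries of the lattice,
  for example \<open>(4, 1, 1)\<close> after \<open>(3, 3, 0)\<close> and \<open>(6, 1, 1)\<close> after \<open>(5, 3, 2)\<close>.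
\<close>

lemma omits_by_lattice:
  assumes R: "meets_all_ell6 R" and N: "\<forall>n\<in>N. omits R n"
    and n: "n = (i' - i)\<^sup>2 + (j' - j)\<^sup>2 + (k' - k)\<^sup>2"
    and no: "\<And>F. lattice_pattern N F \<Longrightarrow> F i j k \<Longrightarrow> F i' j' k' \<Longrightarrow> False"
  shows "omits R n"
  unfolding omits_def using lattice_through_pair[OF R N, of _ _ i' i j' j k' k] no n by metis

lemma five_steps_further:
  assumes R: "meets_all_ell6 R" and R2: "omits R 2"
    and x: "x \<in> R" and v: "norm v = 1"
  shows "x + 5 *\<^sub>R v \<in> R"
proof -
  have o8: "omits R 8"
    by (rule omits_by_lattice[OF R, of "{2}" _ 1 "-1" 1 "-1" 0 0])
      (use R2 no_red_pair_at_distance_2 in auto)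
  have o12: "omits R 12"
    by (rule omits_by_lattice[OF R, of "{2, 8}" _ 2 0 2 0 2 0])
      (use R2 o8 no_red_pair_at_distance_sqrt6 in auto)
  have o18: "omits R 18"
    by (rule omits_by_lattice[OF R, of "{2, 8, 12}" _ 3 0 3 0 0 0])
      (use R2 o8 o12 no_red_pair_at_distance_3 in auto)
  have o32: "omits R 32"
    by (rule omits_by_lattice[OF R, of "{2, 8, 12, 18}" _ 4 0 4 0 0 0])
      (use R2 o8 o12 o18 no_red_pair_at_distance_4 in auto)
  have o38: "omits R 38"
    by (rule omits_by_lattice[OF R, of "{2, 8, 12, 18, 32}" _ 5 0 3 0 2 0])
      (use R2 o8 o12 o18 o32 no_red_pair_at_distance_sqrt19 in auto)
  have o72: "omits R 72"
    by (rule omits_by_lattice[OF R, of "{2, 8, 12, 18, 32, 38}" _ 6 0 6 0 0 0])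
      (use R2 o8 o12 o18 o32 o38 no_red_pair_at_distance_6 in auto)
  \<comment> \<open>The row starts at \<open>x + v\<close>, since a row starting at \<open>x\<close> would meet \<open>R\<close> trivially.\<close>
  obtain k where k: "k < 6" "(x + v) + real k *\<^sub>R v \<in> R"
    using R v unfolding meets_all_ell6_def by blast
  define m where "m = Suc k"
  have m: "x + real m *\<^sub>R v \<in> R"
    using k(2) by (simp add: m_def algebra_simps)
  have "2 * (dist x (x + real m *\<^sub>R v))\<^sup>2 = of_int (2 * (int m)\<^sup>2)"
    using v by (simp add: dist_norm)
  then have "\<not> omits R (2 * (int m)\<^sup>2)"
    using x m unfolding omits_def by blast
  moreover have "m = 1 \<or> m = 2 \<or> m = 3 \<or> m = 4 \<or> m = 5 \<or> m = 6"
    using k(1) unfolding m_def by linarith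
  ultimately have "m = 5"
    using R2 o8 o18 o32 o72 by auto
  then show ?thesis
    using m by simp
qed

theorem theorem3p1:
  fixes c :: "real ^ 3 \<Rightarrow> colour"
  assumes "\<not> (\<exists>x y. c x = Red \<and> c y = Red \<and> dist x y = 1)"
  shows "\<exists>S. forms_ell 6 S \<and> (\<forall>x\<in>S. c x = Blue)"
proof (rule ccontr)
  assume no_blue: "\<not> ?thesis"
  define R where "R = {x. c x = Red}"
  have R: "meets_all_ell6 R"
    unfolding meets_all_ell6_def
  proof (intro allI impI)
    fix p v :: "real^3"
    assume "norm v = 1"
    then have "forms_ell 6 ((\<lambda>k. p + real k *\<^sub>R v) ` {..<6})"
      unfolding forms_ell_def by blast
    then obtain k where "k < 6" "c (p + real k *\<^sub>R v) \<noteq> Blue"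
      using no_blue by blast
    then show "\<exists>k<6. p + real k *\<^sub>R v \<in> R"
      unfolding R_def using colour.exhaust by blast
  qed
  have R2: "omits R 2"
    unfolding omits_def
  proof (intro ballI)
    fix x y
    assume "x \<in> R" "y \<in> R"
    then have "dist x y \<noteq> 1"
      using assms by (auto simp: R_def)
    then show "2 * (dist x y)\<^sup>2 \<noteq> of_int 2"
      using power2_eq_iff_nonneg[of "dist x y" 1] by simp
  qed
  \<comment> \<open>Unit vectors with \<open>5 *\<^sub>R (u - v)\<close> equal to the second basis vector.\<close>
  define u v :: "real^3"
    where "u = vector [sqrt 99 / 10, 1 / 10, 0]" and "v = vector [sqrt 99 / 10, - 1 / 10, 0]"
  have "norm u = 1" "norm v = 1"
    by (simp_all add: u_def v_def norm_eq_1 inner_vec_def sum_3)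
  moreover obtain x where "x \<in> R"
    using R \<open>norm u = 1\<close> unfolding meets_all_ell6_def by blast
  ultimately have "x + 5 *\<^sub>R u \<in> R" "x + 5 *\<^sub>R v \<in> R"
    using five_steps_further[OF R R2] by blast+
  moreover have "dist (x + 5 *\<^sub>R u) (x + 5 *\<^sub>R v) = 1"
    by (simp add: dist_norm norm_eq_1 u_def v_def inner_vec_def sum_3)
  ultimately show False
    using R2 unfolding omits_def by force
qed

end
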